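(* Let $r,q\ge0$ be real numbers, let $l=\{a_i;\ i=1,2,3,\dots\}$ and $h=\{b_i;\ i=1,2,3,\dots\}$ be sequences of real numbers, and let $a,b\in\mathbb{R}$. If $a=\mathrm{stat}\text{-}r\text{-}\lim l$ and $b=\mathrm{stat}\text{-}q\text{-}\lim h$, then: (a) $a+b=\mathrm{stat}\text{-}(r+q)\text{-}\lim(l+h)$; (b) $a-b=\mathrm{stat}\text{-}(r+q)\text{-}\lim(l-h)$; (c) $ka=\mathrm{stat}\text{-}(|k|\cdot r)\text{-}\lim(kl)$ for any $k\in\mathbb{R}$, where $kl=\{ka_i;\ i=1,2,3,\dots\}$.
   Context: $\mathbb{N}=\{1,2,3,\dots\}$. For $K\subseteq\mathbb{N}$ put $K_n=\{k\in K: k\le n\}$; the asymptotic density of $K$ is $d(K)=\lim_{n\to\infty}\frac1n|K_n|$ whenever the limit exists. For a real $r\ge0$, $a=\mathrm{stat}\text{-}r\text{-}\lim l$ means that for every $\varepsilon>0$ the set $\{i\in\mathbb{N}: |a_i-a|\ge r+\varepsilon\}$ has density $0$. The sum and difference of sequences are termwise: $l+h=\{a_i+b_i\}$, $l-h=\{a_i-b_i\}$. *)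

theory Defs
  imports Complex_Main
begin

text \<open>Index sets and sequences start at 1, as in the convention \<open>\<nat> = {1, 2, 3, \<dots>}\<close>.
  A sequence is a function \<^typ>\<open>nat \<Rightarrow> real\<close> whose value at 0 plays no role.
  Since the density need not exist, it is a relation.\<close>

definition has_density :: "nat set \<Rightarrow> real \<Rightarrow> bool" where
  "has_density K d \<longleftrightarrow> (\<lambda>n. real (card (K \<inter> {1..n})) / real n) \<longlonglongrightarrow> d"

text \<open>\<open>stat_lim r l a\<close> stands for \<open>a = stat-r-lim l\<close>. Such an \<open>a\<close> need not be
  unique when \<open>r > 0\<close>, so this too is a relation. It is meant for \<open>r \<ge> 0\<close>.\<close>

definition stat_lim :: "real \<Rightarrow> (nat \<Rightarrow> real) \<Rightarrow> real \<Rightarrow> bool" where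
  "stat_lim r l a \<longleftrightarrow>
     (\<forall>\<epsilon>>0. has_density {i. 1 \<le> i \<and> \<bar>l i - a\<bar> \<ge> r + \<epsilon>} 0)"

end

theory Submission
  imports Defs
begin

text \<open>The sets of density 0 form an ideal: they are closed under subsets and finite unions.
  If a termwise sum deviates from \<open>a + b\<close> by at least \<open>r + q + \<epsilon>\<close>, then by the triangle
  inequality one of the summands deviates from its own limit by at least \<open>r + \<epsilon> / 2\<close> or
  \<open>q + \<epsilon> / 2\<close>, so the exceptional set of the sum lies in a union of two null sets. Scaling by
  \<open>k \<noteq> 0\<close> turns the exceptional set for \<open>\<epsilon>\<close> into the one for \<open>\<epsilon> / \<bar>k\<bar>\<close> of the original
  sequence. The difference is the sum with the second sequence scaled by \<open>-1\<close>.\<close>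

lemma has_density_0_empty: "has_density {} 0"
  by (simp add: has_density_def)

lemma has_density_0_subset:
  assumes "has_density B 0" and "A \<subseteq> B"
  shows "has_density A 0"
  unfolding has_density_def
proof (rule tendsto_sandwich[where f = "\<lambda>_. 0"])
  have "card (A \<inter> {1..n}) \<le> card (B \<inter> {1..n})" for n
    using assms(2) by (intro card_mono) auto
  then show "\<forall>\<^sub>F n in sequentially.
      real (card (A \<inter> {1..n})) / real n \<le> real (card (B \<inter> {1..n})) / real n"
    by (intro always_eventually allI divide_right_mono) auto
  show "(\<lambda>n. real (card (B \<inter> {1..n})) / real n) \<longlonglongrightarrow> 0"
    using assms(1) by (simp add: has_density_def)
qed auto

lemma has_density_0_Un:
  assumes "has_density A 0" and "has_density B 0"
  shows "has_density (A \<union> B) 0"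
  unfolding has_density_def
proof (rule tendsto_sandwich[where f = "\<lambda>_. 0"])
  have "real (card ((A \<union> B) \<inter> {1..n}))
      \<le> real (card (A \<inter> {1..n})) + real (card (B \<inter> {1..n}))" for n
    using card_Un_le[of "A \<inter> {1..n}" "B \<inter> {1..n}"] by (simp add: Int_Un_distrib2)
  then show "\<forall>\<^sub>F n in sequentially. real (card ((A \<union> B) \<inter> {1..n})) / real n
      \<le> real (card (A \<inter> {1..n})) / real n + real (card (B \<inter> {1..n})) / real n"
    unfolding add_divide_distrib[symmetric]
    by (intro always_eventually allI divide_right_mono) auto
  show "(\<lambda>n. real (card (A \<inter> {1..n})) / real n + real (card (B \<inter> {1..n})) / real n) \<longlonglongrightarrow> 0"
    using tendsto_add[OF assms[unfolded has_density_def]] by simp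
qed auto

lemma stat_lim_add:
  assumes "stat_lim r l a" and "stat_lim q h b"
  shows "stat_lim (r + q) (\<lambda>i. l i + h i) (a + b)"
  unfolding stat_lim_def
proof (intro allI impI)
  fix \<epsilon> :: real
  assume "\<epsilon> > 0"
  then have "has_density {i. 1 \<le> i \<and> \<bar>l i - a\<bar> \<ge> r + \<epsilon> / 2} 0"
    and "has_density {i. 1 \<le> i \<and> \<bar>h i - b\<bar> \<ge> q + \<epsilon> / 2} 0"
    using assms by (simp_all add: stat_lim_def)
  from has_density_0_Un[OF this]
  show "has_density {i. 1 \<le> i \<and> \<bar>l i + h i - (a + b)\<bar> \<ge> r + q + \<epsilon>} 0"
    by (rule has_density_0_subset) auto
qed

lemma stat_lim_mult_left:
  assumes "stat_lim r l a"
  shows "stat_lim (\<bar>k\<bar> * r) (\<lambda>i. k * l i) (k * a)"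
proof (cases "k = 0")
  case True
  \<comment> \<open>The scaled sequence is constantly its limit, so no term deviates by \<open>\<epsilon> > 0\<close>.\<close>
  then show ?thesis
    by (auto simp: stat_lim_def has_density_0_empty)
next
  case False
  show ?thesis
    unfolding stat_lim_def
  proof (intro allI impI)
    fix \<epsilon> :: real
    assume "\<epsilon> > 0"
    have "\<bar>k * l i - k * a\<bar> \<ge> \<bar>k\<bar> * r + \<epsilon> \<longleftrightarrow> \<bar>l i - a\<bar> \<ge> r + \<epsilon> / \<bar>k\<bar>" for i
    proof -
      have "\<bar>k * l i - k * a\<bar> = \<bar>k\<bar> * \<bar>l i - a\<bar>"
        by (simp add: abs_mult[symmetric] right_diff_distrib)
      moreover have "\<bar>k\<bar> * r + \<epsilon> = \<bar>k\<bar> * (r + \<epsilon> / \<bar>k\<bar>)"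
        using False by (simp add: distrib_left)
      ultimately show ?thesis
        using False by simp
    qed
    moreover have "\<epsilon> / \<bar>k\<bar> > 0"
      using \<open>\<epsilon> > 0\<close> False by simp
    ultimately show "has_density {i. 1 \<le> i \<and> \<bar>k * l i - k * a\<bar> \<ge> \<bar>k\<bar> * r + \<epsilon>} 0"
      using assms by (simp add: stat_lim_def)
  qed
qed

theorem theorem3p6:
  fixes r q :: real and l h :: "nat \<Rightarrow> real" and a b :: real
  assumes "r \<ge> 0" and "q \<ge> 0"
    and "stat_lim r l a" and "stat_lim q h b"
  shows "stat_lim (r + q) (\<lambda>i. l i + h i) (a + b)
    \<and> stat_lim (r + q) (\<lambda>i. l i - h i) (a - b)
    \<and> (\<forall>k::real. stat_lim (\<bar>k\<bar> * r) (\<lambda>i. k * l i) (k * a))"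
proof (intro conjI allI)
  show "stat_lim (r + q) (\<lambda>i. l i + h i) (a + b)"
    using assms(3,4) by (rule stat_lim_add)
  have "stat_lim q (\<lambda>i. - h i) (- b)"
    using stat_lim_mult_left[OF assms(4), of "- 1"] by simp
  from stat_lim_add[OF assms(3) this]
  show "stat_lim (r + q) (\<lambda>i. l i - h i) (a - b)"
    by simp
  show "stat_lim (\<bar>k\<bar> * r) (\<lambda>i. k * l i) (k * a)" for k
    using assms(3) by (rule stat_lim_mult_left)
qed

end
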